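(* (Cassini's identity) For $n\in\mathbb{N}$: 1. $M\mathbb{O}_{k,n+1}M\mathbb{O}_{k,n-1}-M\mathbb{O}_{k,n}^2=\dfrac{2^{n-1}\left[\alpha\beta(2-\lambda_1^{2})+\beta\alpha(2-\lambda_2^{2})\right]}{9k^2-8}$; 2. $M\mathbb{O}_{k,n-1}M\mathbb{O}_{k,n+1}-M\mathbb{O}_{k,n}^2=\dfrac{2^{n-1}\left[\alpha\beta(2-\lambda_2^{2})+\beta\alpha(2-\lambda_1^{2})\right]}{9k^2-8}$. Here $\alpha=\sum_{r=0}^{7}\lambda_1^{r}e_r$ and $\beta=\sum_{r=0}^{7}\lambda_2^{r}e_r$.
   Context: $\mathbb{N}$ is the set of positive integers. $\mathbb{O}$ denotes the octonions, the $8$-dimensional real (non-commutative, non-associative) algebra with basis $e_0=1,e_1,\dots,e_7$ and bilinear multiplication determined by: $e_0$ is the identity, $e_a^2=-1$ for $a\ge1$, $e_ae_b=-e_be_a$ for distinct $a,b\ge1$, and $e_ae_b=e_c$, $e_be_c=e_a$, $e_ce_a=e_b$ for $(a,b,c)\in\{(1,2,3),(1,4,5),(1,7,6),(2,4,6),(2,5,7),(3,4,7),(3,6,5)\}$. For a parameter $k$, the $k$-Mersenne numbers are defined by $M_{k,0}=0$, $M_{k,1}=1$, $M_{k,n+1}=3kM_{k,n}-2M_{k,n-1}$ for $n\ge1$. The $n$-th $k$-Mersenne octonion is $M\mathbb{O}_{k,n}=\sum_{r=0}^{7}M_{k,n+r}e_r$ for $n\ge 0$. The numbers $\lambda_1=\frac{3k+\sqrt{9k^2-8}}{2}$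 and $\lambda_2=\frac{3k-\sqrt{9k^2-8}}{2}$ are the roots of $\lambda^2-3k\lambda+2=0$. *)

theory Defs
  imports Complex_Main
begin

text \<open>An octonion is given by its real coordinates 0, ..., 7 with respect to
  \<open>e\<^sub>0, \<dots>, e\<^sub>7\<close>; the coordinates from 8 on are padding.\<close>

typedef octonion = "{f :: nat \<Rightarrow> real. \<forall>i\<ge>8. f i = 0}"
  morphisms coord Octonion
  by (rule exI[of _ "\<lambda>_. 0"]) simp

lemma coord_ge_8 [simp]: "i \<ge> 8 \<Longrightarrow> coord x i = 0"
  using coord[of x] by simp

lemma coord_Octonion: "(\<And>i. i \<ge> 8 \<Longrightarrow> f i = 0) \<Longrightarrow> coord (Octonion f) = f"
  by (simp add: Octonion_inverse)

lemma octonion_eqI: "(\<And>i. i < 8 \<Longrightarrow> coord x i = coord y i) \<Longrightarrow> x = y"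
  by (metis coord_ge_8 coord_inject ext linorder_not_less)

instantiation octonion :: real_vector
begin

definition "0 = Octonion (\<lambda>_. 0)"
definition "x + y = Octonion (\<lambda>i. coord x i + coord y i)"
definition "- x = Octonion (\<lambda>i. - coord x i)"
definition "x - y = Octonion (\<lambda>i. coord x i - coord y i)"
definition "c *\<^sub>R x = Octonion (\<lambda>i. c * coord x i)"

lemma coord_linear [simp]:
  "coord 0 i = 0"
  "coord (x + y) i = coord x i + coord y i"
  "coord (- x) i = - coord x i"
  "coord (x - y) i = coord x i - coord y i"
  "coord (c *\<^sub>R x) i = c * coord x i"
  by (simp_all add: zero_octonion_def plus_octonion_def uminus_octonion_def
      minus_octonion_def scaleR_octonion_def coord_Octonion)

instance
  by standard (auto intro!: octonion_eqI simp: algebra_simps)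

end

definition oct_e :: "nat \<Rightarrow> octonion" where
  "oct_e a = Octonion (\<lambda>i. if i = a \<and> a < 8 then 1 else 0)"

lemma coord_oct_e: "coord (oct_e a) i = (if i = a \<and> a < 8 then 1 else 0)"
  by (simp add: oct_e_def coord_Octonion)

definition oct_triples :: "(nat \<times> nat \<times> nat) set" where
  "oct_triples = {(1,2,3), (1,4,5), (1,7,6), (2,4,6), (2,5,7), (3,4,7), (3,6,5)}"

definition oct_cyclic :: "nat \<Rightarrow> nat \<Rightarrow> nat \<Rightarrow> bool" where
  "oct_cyclic a b c \<longleftrightarrow>
     (a, b, c) \<in> oct_triples \<or> (b, c, a) \<in> oct_triples \<or> (c, a, b) \<in> oct_triples"

text \<open>The coefficient of \<open>e\<^sub>c\<close> in the product \<open>e\<^sub>a e\<^sub>b\<close>.\<close>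

definition oct_struct :: "nat \<Rightarrow> nat \<Rightarrow> nat \<Rightarrow> real" where
  "oct_struct a b c =
     (if a = 0 then (if c = b then 1 else 0)
      else if b = 0 then (if c = a then 1 else 0)
      else if a = b then (if c = 0 then -1 else 0)
      else if oct_cyclic a b c then 1
      else if oct_cyclic b a c then -1
      else 0)"

text \<open>The product is not associative, so only the syntactic class \<open>power\<close> is
  instantiated; \<open>x ^ 2\<close> is \<open>x * (x * 1)\<close>, which is \<open>x * x\<close> as 1 is the identity.\<close>

instantiation octonion :: "{times, one, power}"
begin

definition "1 = oct_e 0"

definition "x * y = Octonion (\<lambda>c. if c < 8
   then \<Sum>a<8. \<Sum>b<8. coord x a * coord y b * oct_struct a b c else 0)"

instance ..

end

lemma coord_times:
  "coord (x * y) c =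
    (if c < 8 then \<Sum>a<8. \<Sum>b<8. coord x a * coord y b * oct_struct a b c else 0)"
  by (simp add: times_octonion_def coord_Octonion)

lemma oct_times_linear:
  fixes x y z :: octonion
  shows "(x + y) * z = x * z + y * z" "x * (y + z) = x * y + x * z"
    "(c *\<^sub>R x) * y = c *\<^sub>R (x * y)" "x * (c *\<^sub>R y) = c *\<^sub>R (x * y)"
  by (auto intro!: octonion_eqI
      simp: coord_times algebra_simps sum.distrib sum_distrib_left)

lemma sum_less_8:
  fixes f :: "nat \<Rightarrow> 'a::comm_monoid_add"
  shows "(\<Sum>r<8. f r) = f 0 + f 1 + f 2 + f 3 + f 4 + f 5 + f 6 + f 7"
  by (simp add: eval_nat_numeral)

lemma coord_oct_e_times:
  assumes "a < 8" "b < 8" "c < 8"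
  shows "coord (oct_e a * oct_e b) c = oct_struct a b c"
proof -
  have "coord (oct_e a * oct_e b) c =
      (\<Sum>i<8. \<Sum>j<8. coord (oct_e a) i * coord (oct_e b) j * oct_struct i j c)"
    using assms by (simp add: coord_times)
  also have "\<dots> = (\<Sum>i<8. \<Sum>j<8. if j = b then (if i = a then oct_struct i j c else 0) else 0)"
    by (intro sum.cong refl) (use assms in \<open>auto simp: coord_oct_e\<close>)
  also have "\<dots> = oct_struct a b c"
    using assms by simp
  finally show ?thesis .
qed

lemma oct_times_one: "1 * x = (x::octonion)" "x * 1 = (x::octonion)"
proof -
  have "(\<Sum>a<8. \<Sum>b<8. coord 1 a * coord x b * oct_struct a b c) = coord x c"
    if "c < 8" for c
  proof -
    have "(\<Sum>a<8. \<Sum>b<8. coord 1 a * coord x b * oct_struct a b c)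
        = (\<Sum>a<(8::nat). \<Sum>b<(8::nat). if b = c then (if a = 0 then coord x b else 0) else 0)"
      by (intro sum.cong refl) (auto simp: one_octonion_def coord_oct_e oct_struct_def)
    then show ?thesis using that by simp
  qed
  then show "1 * x = x" by (auto intro!: octonion_eqI simp: coord_times)
  have "(\<Sum>a<8. \<Sum>b<8. coord x a * coord 1 b * oct_struct a b c) = coord x c"
    if "c < 8" for c
  proof -
    have "(\<Sum>a<8. \<Sum>b<8. coord x a * coord 1 b * oct_struct a b c)
        = (\<Sum>a<(8::nat). \<Sum>b<(8::nat). if b = 0 then (if a = c then coord x a else 0) else 0)"
      by (intro sum.cong refl) (auto simp: one_octonion_def coord_oct_e oct_struct_def)
    then show ?thesis using that by simp
  qed
  then show "x * 1 = x" by (auto intro!: octonion_eqI simp: coord_times)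
qed

lemma oct_power2: "(x::octonion) ^ 2 = x * x"
  by (simp add: eval_nat_numeral oct_times_one)

lemma oct_e_square: "1 \<le> a \<Longrightarrow> a < 8 \<Longrightarrow> oct_e a * oct_e a = - 1"
  by (auto intro!: octonion_eqI simp: coord_oct_e_times one_octonion_def coord_oct_e
      oct_struct_def)

definition oct_cyclic_triples :: "(nat \<times> nat \<times> nat) set" where
  "oct_cyclic_triples =
    {(1,2,3), (2,3,1), (3,1,2), (1,4,5), (4,5,1), (5,1,4), (1,7,6),
     (7,6,1), (6,1,7), (2,4,6), (4,6,2), (6,2,4), (2,5,7), (5,7,2),
     (7,2,5), (3,4,7), (4,7,3), (7,3,4), (3,6,5), (6,5,3), (5,3,6)}"

lemma oct_cyclic_triples: "oct_cyclic a b c \<Longrightarrow> (a, b, c) \<in> oct_cyclic_triples"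
  unfolding oct_cyclic_def oct_triples_def oct_cyclic_triples_def
  by (elim disjE; simp; elim disjE conjE; simp)

lemma oct_cyclic_unique:
  assumes "oct_cyclic a b c" "oct_cyclic a b d"
  shows "c = d"
proof -
  have "\<forall>p \<in> oct_cyclic_triples. \<forall>q \<in> oct_cyclic_triples.
      fst p = fst q \<longrightarrow> fst (snd p) = fst (snd q) \<longrightarrow> snd (snd p) = snd (snd q)"
    by (simp add: oct_cyclic_triples_def)
  from this[THEN bspec, OF oct_cyclic_triples[OF assms(1)],
      THEN bspec, OF oct_cyclic_triples[OF assms(2)]]
  show ?thesis by simp
qed

lemma oct_cyclic_asym:
  assumes "oct_cyclic a b c"
  shows "\<not> oct_cyclic b a d"
proof
  assume "oct_cyclic b a d"
  have "\<forall>p \<in> oct_cyclic_triples. \<forall>q \<in> oct_cyclic_triples.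
      fst p = fst (snd q) \<longrightarrow> fst (snd p) \<noteq> fst q"
    by (simp add: oct_cyclic_triples_def)
  from this[THEN bspec, OF oct_cyclic_triples[OF assms],
      THEN bspec, OF oct_cyclic_triples[OF \<open>oct_cyclic b a d\<close>]]
  show False by simp
qed

lemma oct_cyclic_range:
  assumes "oct_cyclic a b c"
  shows "1 \<le> a \<and> a < 8 \<and> 1 \<le> b \<and> b < 8 \<and> a \<noteq> b \<and> c < 8"
proof -
  have "\<forall>(a, b, c) \<in> oct_cyclic_triples. 1 \<le> a \<and> a < 8 \<and> 1 \<le> b \<and> b < 8 \<and> a \<noteq> b \<and> c < 8"
    by (simp add: oct_cyclic_triples_def)
  from this[THEN bspec, OF oct_cyclic_triples[OF assms]] show ?thesis by simp
qed

lemma oct_e_cyclic: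
  assumes "oct_cyclic a b c"
  shows "oct_e a * oct_e b = oct_e c"
proof (rule octonion_eqI)
  fix i :: nat
  assume i: "i < 8"
  have range: "a \<noteq> 0" "b \<noteq> 0" "a \<noteq> b" "a < 8" "b < 8" "c < 8"
    using oct_cyclic_range[OF assms] by simp_all
  have "oct_cyclic a b i \<longleftrightarrow> i = c"
    using assms oct_cyclic_unique by blast
  moreover have "\<not> oct_cyclic b a i"
    using assms by (rule oct_cyclic_asym)
  ultimately have "oct_struct a b i = (if i = c then 1 else 0)"
    using range by (simp add: oct_struct_def)
  then show "coord (oct_e a * oct_e b) i = coord (oct_e c) i"
    using range i by (simp add: coord_oct_e_times coord_oct_e)
qed

lemma oct_e_triples:
  assumes "(a, b, c) \<in> oct_triples"
  shows "oct_e a * oct_e b = oct_e c" "oct_e b * oct_e c = oct_e a"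
    "oct_e c * oct_e a = oct_e b"
  using assms by (auto intro!: oct_e_cyclic simp: oct_cyclic_def)

lemma oct_e_anticommute:
  assumes "1 \<le> a" "a < 8" "1 \<le> b" "b < 8" "a \<noteq> b"
  shows "oct_e a * oct_e b = - (oct_e b * oct_e a)"
proof (rule octonion_eqI)
  fix i :: nat
  assume "i < 8"
  then show "coord (oct_e a * oct_e b) i = coord (- (oct_e b * oct_e a)) i"
    using assms oct_cyclic_asym[of a b i i]
    by (auto simp: coord_oct_e_times oct_struct_def)
qed

fun mersenne :: "real \<Rightarrow> nat \<Rightarrow> real" where
  "mersenne k 0 = 0"
| "mersenne k (Suc 0) = 1"
| "mersenne k (Suc (Suc n)) = 3 * k * mersenne k (Suc n) - 2 * mersenne k n"

definition mersenne_oct :: "real \<Rightarrow> nat \<Rightarrow> octonion" where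
  "mersenne_oct k n = (\<Sum>r\<le>7. mersenne k (n + r) *\<^sub>R oct_e r)"

definition lambda1 :: "real \<Rightarrow> real" where
  "lambda1 k = (3 * k + sqrt (9 * k\<^sup>2 - 8)) / 2"

definition lambda2 :: "real \<Rightarrow> real" where
  "lambda2 k = (3 * k - sqrt (9 * k\<^sup>2 - 8)) / 2"

definition alpha :: "real \<Rightarrow> octonion" where
  "alpha k = (\<Sum>r\<le>7. lambda1 k ^ r *\<^sub>R oct_e r)"

definition beta :: "real \<Rightarrow> octonion" where
  "beta k = (\<Sum>r\<le>7. lambda2 k ^ r *\<^sub>R oct_e r)"

end

theory Submission
  imports Defs
begin

text \<open>
  By the Binet formula, \<open>\<surd>(9k\<^sup>2 - 8) M\<^sub>n = \<lambda>\<^sub>1\<^sup>n - \<lambda>\<^sub>2\<^sup>n\<close>, so coordinatewise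
  \<open>\<surd>(9k\<^sup>2 - 8) MO\<^sub>n = \<lambda>\<^sub>1\<^sup>n \<alpha> - \<lambda>\<^sub>2\<^sup>n \<beta>\<close> (lemma \<open>mersenne_oct_binet\<close>). The rest
  uses the bilinearity of the octonion product only: in a difference of two products
  of such terms with equal index sums, the squares \<open>\<alpha>\<alpha>\<close> and \<open>\<beta>\<beta>\<close> carry
  equal coefficients and cancel, and the mixed products \<open>\<alpha>\<beta>\<close> and \<open>\<beta>\<alpha>\<close> stay
  apart because the algebra is not commutative (lemma \<open>binet_products_diff\<close>). Both
  Cassini identities are instances, after reducing the coefficients by
  \<open>\<lambda>\<^sub>1 \<lambda>\<^sub>2 = 2\<close>.
\<close>

lemma oct_times_diff:
  fixes x y z :: octonion
  shows "(x - y) * z = x * z - y * z" "x * (y - z) = x * y - x * z"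
  by (auto intro!: octonion_eqI simp: coord_times algebra_simps sum_subtractf)

lemma lambda_product:
  assumes "9 * k\<^sup>2 - 8 \<ge> 0"
  shows "lambda1 k * lambda2 k = 2"
proof -
  have "lambda1 k * lambda2 k = ((3 * k)\<^sup>2 - (sqrt (9 * k\<^sup>2 - 8))\<^sup>2) / 4"
    by (simp add: lambda1_def lambda2_def power2_eq_square algebra_simps)
  also have "\<dots> = 2"
    using assms by (simp add: power_mult_distrib)
  finally show ?thesis .
qed

lemma lambda_sum: "lambda1 k + lambda2 k = 3 * k"
  by (simp add: lambda1_def lambda2_def field_simps)

lemma lambda_diff: "lambda1 k - lambda2 k = sqrt (9 * k\<^sup>2 - 8)"
  by (simp add: lambda1_def lambda2_def field_simps)

text \<open>
  Both \<open>\<lambda>\<^sub>1\<^sup>n\<close> and \<open>\<lambda>\<^sub>2\<^sup>n\<close> solve the Mersenne recurrence, whose coefficients are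
  the sum and the product of the roots. The difference of the roots stays undivided,
  so that the identity covers the double root as well.
\<close>

lemma mersenne_binet:
  assumes "9 * k\<^sup>2 - 8 \<ge> 0"
  shows "(lambda1 k - lambda2 k) * mersenne k n = lambda1 k ^ n - lambda2 k ^ n"
proof (induction n rule: induct_nat_012)
  case (ge2 n)
  let ?p = "lambda1 k" and ?q = "lambda2 k"
  have "(?p - ?q) * mersenne k (Suc (Suc n))
      = 3 * k * ((?p - ?q) * mersenne k (Suc n)) - 2 * ((?p - ?q) * mersenne k n)"
    by (simp add: algebra_simps)
  also have "\<dots> = (?p + ?q) * (?p ^ Suc n - ?q ^ Suc n) - (?p * ?q) * (?p ^ n - ?q ^ n)"
    by (simp only: ge2.IH lambda_sum lambda_product[OF assms])
  also have "\<dots> = ?p ^ Suc (Suc n) - ?q ^ Suc (Suc n)"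
    by (simp add: algebra_simps)
  finally show ?case .
qed simp_all

lemma mersenne_oct_binet:
  assumes "9 * k\<^sup>2 - 8 \<ge> 0"
  shows "(lambda1 k - lambda2 k) *\<^sub>R mersenne_oct k n
    = lambda1 k ^ n *\<^sub>R alpha k - lambda2 k ^ n *\<^sub>R beta k"
  by (simp add: mersenne_oct_def alpha_def beta_def scaleR_sum_right mersenne_binet[OF assms]
      power_add scaleR_left_diff_distrib sum_subtractf)

text \<open>
  The coefficients of \<open>x * x\<close> and \<open>y * y\<close> are the powers of \<open>p\<close> and \<open>q\<close> to the
  sum of the two indices, so they cancel when the index sums agree.
\<close>

lemma binet_products_diff:
  fixes x y :: octonion and p q :: real
  defines "u \<equiv> \<lambda>i. p ^ i *\<^sub>R x - q ^ i *\<^sub>R y"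
  assumes "a + b = c + d"
  shows "u a * u b - u c * u d
    = (p ^ c * q ^ d - p ^ a * q ^ b) *\<^sub>R (x * y)
      + (q ^ c * p ^ d - q ^ a * p ^ b) *\<^sub>R (y * x)"
proof -
  have expand: "u i * u j = (p ^ i * p ^ j) *\<^sub>R (x * x) - (p ^ i * q ^ j) *\<^sub>R (x * y)
      - (q ^ i * p ^ j) *\<^sub>R (y * x) + (q ^ i * q ^ j) *\<^sub>R (y * y)" for i j
    unfolding u_def oct_times_diff oct_times_linear scaleR_right_diff_distrib scaleR_scaleR
    by (simp add: mult.commute)
  have squares: "p ^ a * p ^ b = p ^ c * p ^ d" "q ^ a * q ^ b = q ^ c * q ^ d"
    using assms(2) by (simp_all flip: power_add)
  show ?thesis
    unfolding expand squares scaleR_left_diff_distrib by simp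
qed

lemma mersenne_oct_products_diff:
  assumes "9 * k\<^sup>2 - 8 > 0" "a + b = c + d"
  shows "mersenne_oct k a * mersenne_oct k b - mersenne_oct k c * mersenne_oct k d
    = ((lambda1 k ^ c * lambda2 k ^ d - lambda1 k ^ a * lambda2 k ^ b) *\<^sub>R (alpha k * beta k)
       + (lambda2 k ^ c * lambda1 k ^ d - lambda2 k ^ a * lambda1 k ^ b) *\<^sub>R (beta k * alpha k))
      /\<^sub>R (9 * k\<^sup>2 - 8)"
    (is "?L = ?R /\<^sub>R _")
proof -
  let ?\<delta> = "lambda1 k - lambda2 k"
  have square: "?\<delta> * ?\<delta> = 9 * k\<^sup>2 - 8"
    using assms(1) by (simp add: lambda_diff)
  have "(?\<delta> * ?\<delta>) *\<^sub>R ?L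
      = (?\<delta> *\<^sub>R mersenne_oct k a) * (?\<delta> *\<^sub>R mersenne_oct k b)
        - (?\<delta> *\<^sub>R mersenne_oct k c) * (?\<delta> *\<^sub>R mersenne_oct k d)"
    by (simp add: oct_times_linear scaleR_right_diff_distrib)
  also have "\<dots> = ?R"
    using assms by (simp add: mersenne_oct_binet binet_products_diff)
  finally have "(9 * k\<^sup>2 - 8) *\<^sub>R ?L = ?R"
    by (simp only: square)
  then have "?R /\<^sub>R (9 * k\<^sup>2 - 8) = ((9 * k\<^sup>2 - 8) *\<^sub>R ?L) /\<^sub>R (9 * k\<^sup>2 - 8)"
    by simp
  with assms(1) show ?thesis
    by simp
qed

theorem theorem2p4:
  fixes k :: real and n :: nat
  assumes "9 * k\<^sup>2 - 8 > 0" and "n \<ge> 1"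
  shows "(mersenne_oct k (n + 1) * mersenne_oct k (n - 1) - (mersenne_oct k n)\<^sup>2 =
      (2 ^ (n - 1) *\<^sub>R ((2 - (lambda1 k)\<^sup>2) *\<^sub>R (alpha k * beta k) +
                         (2 - (lambda2 k)\<^sup>2) *\<^sub>R (beta k * alpha k))) /\<^sub>R (9 * k\<^sup>2 - 8))
    \<and> (mersenne_oct k (n - 1) * mersenne_oct k (n + 1) - (mersenne_oct k n)\<^sup>2 =
      (2 ^ (n - 1) *\<^sub>R ((2 - (lambda2 k)\<^sup>2) *\<^sub>R (alpha k * beta k) +
                         (2 - (lambda1 k)\<^sup>2) *\<^sub>R (beta k * alpha k))) /\<^sub>R (9 * k\<^sup>2 - 8))"
proof -
  obtain m where n: "n = Suc m"
    using assms(2) by (cases n) auto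
  let ?p = "lambda1 k" and ?q = "lambda2 k"
  have prod: "?p * ?q = 2"
    using assms(1) by (simp add: lambda_product)
  have prod_power: "?p ^ m * ?q ^ m = 2 ^ m"
    by (simp add: prod flip: power_mult_distrib)
  have "?p ^ n * ?q ^ n = 2 ^ n"
    by (simp add: prod flip: power_mult_distrib)
  then have middle: "?p ^ n * ?q ^ n = 2 ^ m * 2"
    by (simp only: n power_Suc2)
  have p_high: "?p ^ (n + 1) * ?q ^ (n - 1) = 2 ^ m * ?p\<^sup>2"
    using prod_power by (simp add: n power2_eq_square algebra_simps)
  have q_high: "?q ^ (n + 1) * ?p ^ (n - 1) = 2 ^ m * ?q\<^sup>2"
    using prod_power by (simp add: n power2_eq_square algebra_simps)
  have coeffs:
    "?p ^ n * ?q ^ n - ?p ^ (n + 1) * ?q ^ (n - 1) = 2 ^ (n - 1) * (2 - ?p\<^sup>2)"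
    "?q ^ n * ?p ^ n - ?q ^ (n + 1) * ?p ^ (n - 1) = 2 ^ (n - 1) * (2 - ?q\<^sup>2)"
    "?p ^ n * ?q ^ n - ?p ^ (n - 1) * ?q ^ (n + 1) = 2 ^ (n - 1) * (2 - ?q\<^sup>2)"
    "?q ^ n * ?p ^ n - ?q ^ (n - 1) * ?p ^ (n + 1) = 2 ^ (n - 1) * (2 - ?p\<^sup>2)"
    using middle p_high q_high by (simp_all add: n right_diff_distrib mult.commute)
  have indices: "(n + 1) + (n - 1) = n + n" "(n - 1) + (n + 1) = n + n"
    by (simp_all add: n)
  show ?thesis
    unfolding oct_power2 mersenne_oct_products_diff[OF assms(1) indices(1)]
      mersenne_oct_products_diff[OF assms(1) indices(2)] coeffs
    by (simp only: scaleR_add_right scaleR_scaleR)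
qed

end
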